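(* Let $X$ be a weighted graph on $n$ vertices, let $M\in\{A(X),L(X),Q(X)\}$ and $U(t)=e^{\mathrm{i}tM}$. Then $\epsilon$-uniform mixing occurs in $X$ (relative to $M$) if and only if there exists a sequence $\{\tau_m\}\subseteq\mathbb{R}$ such that $\lim_{m\to\infty}\sqrt{n}\,U(\tau_m)=\mathcal{H}$, where $\mathcal{H}$ is a symmetric complex Hadamard matrix. Additionally, if $M\in\{A(X),L(X)\}$, then $\mathcal{H}$ is non-dephased.
   Context: Graphs are finite, simple, undirected and connected, with positive real edge weights. $A(X)$ is the weighted adjacency matrix, $D(X)$ is the diagonal matrix of vertex degrees (degree = sum of weights of incident edges), $L(X)=D(X)-A(X)$, $Q(X)=D(X)+A(X)$. $\mathbf{e}_u$ is the characteristic vector of $u$, $\mathbf{1}$ the all-ones vector, $\circ$ the entrywise product. $\epsilon$-uniform mixing occurs in $X$ relative to $M$ if for each $\epsilon>0$ there is a $\tau\in\mathbb{R}$ such that $\big\|(U(\tau)\mathbf{e}_u)\circ(\overline{U(\tau)}\mathbf{e}_u)-\tfrac1n\mathbf{1}\big\|<\epsilon$ simultaneously for all vertices $u$ of $X$. An $n\times n$ matrix $\mathcal{H}$ is a complex Hadamard matrix if all its entries are complex numbers of modulus $1$ and $\mathcal{H}\overline{\mathcal{H}}^T=nI$. A complex Hadamard matrix is dephased if its first row and first column are all ones, and non-dephased otherwise.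
   Formalization: The additional claim that H is non-dephased is stated for graphs with n ≥ 2 vertices only; for the one-vertex graph A = L = 0, so H = [1] is dephased and the claim fails. *)

theory Defs
  imports "HOL-Analysis.Analysis"
begin

text \<open>
  The vertex set is a whole finite type \<open>'v\<close> and edges are two-element vertex sets. Weights are
  only constrained on edges; values of \<open>w\<close> elsewhere are never used.
\<close>

locale weighted_graph =
  fixes E :: "'v::finite set set" and w :: "'v set \<Rightarrow> real"
  assumes edge_card: "e \<in> E \<Longrightarrow> card e = 2"
    and weight_pos: "e \<in> E \<Longrightarrow> w e > 0"
    and connected: "(\<lambda>x y. {x, y} \<in> E)\<^sup>*\<^sup>* u v"

definition adjacency_matrix :: "'v::finite set set \<Rightarrow> ('v set \<Rightarrow> real) \<Rightarrow> real^'v^'v" where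
  "adjacency_matrix E w = (\<chi> u v. if {u, v} \<in> E then w {u, v} else 0)"

definition degree_matrix :: "'v::finite set set \<Rightarrow> ('v set \<Rightarrow> real) \<Rightarrow> real^'v^'v" where
  "degree_matrix E w = (\<chi> u v. if u = v then (\<Sum>e\<in>{e \<in> E. u \<in> e}. w e) else 0)"

definition laplacian_matrix :: "'v::finite set set \<Rightarrow> ('v set \<Rightarrow> real) \<Rightarrow> real^'v^'v" where
  "laplacian_matrix E w = degree_matrix E w - adjacency_matrix E w"

definition signless_laplacian_matrix :: "'v::finite set set \<Rightarrow> ('v set \<Rightarrow> real) \<Rightarrow> real^'v^'v" where
  "signless_laplacian_matrix E w = degree_matrix E w + adjacency_matrix E w"

text \<open>
  On \<open>'a^'n\<close> the library's multiplication \<open>*\<close> (hence also \<open>^\<close>) is entrywise, so powers with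
  respect to the matrix product \<open>**\<close> are introduced separately.
\<close>

primrec matrix_pow :: "'a::semiring_1^'n^'n \<Rightarrow> nat \<Rightarrow> 'a^'n^'n" where
  "matrix_pow M 0 = mat 1"
| "matrix_pow M (Suc k) = M ** matrix_pow M k"

definition matrix_exp :: "complex^'n^'n \<Rightarrow> complex^'n^'n" where
  "matrix_exp M = (\<Sum>k. (1 / fact k) *\<^sub>R matrix_pow M k)"

definition transition_matrix :: "real^'v^'v \<Rightarrow> real \<Rightarrow> complex^'v^'v" where
  "transition_matrix M t =
     matrix_exp (map_matrix (\<lambda>x. \<i> * complex_of_real t * complex_of_real x) M)"

text \<open>
  Here \<open>*\<close> is the entrywise product of vectors, \<open>axis u 1\<close> the characteristic vector of \<open>u\<close>,
  and \<open>1\<close> under the scalar \<open>1 / n\<close> the all-ones vector.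
\<close>

definition eps_uniform_mixing :: "real^'v^'v \<Rightarrow> bool" where
  "eps_uniform_mixing M \<longleftrightarrow>
     (\<forall>\<epsilon>>0. \<exists>\<tau>. \<forall>u::'v.
        norm ((transition_matrix M \<tau> *v axis u 1) * (map_matrix cnj (transition_matrix M \<tau>) *v axis u 1)
              - (1 / real CARD('v)) *\<^sub>R (1 :: complex^'v)) < \<epsilon>)"

definition complex_hadamard :: "complex^'n^'n \<Rightarrow> bool" where
  "complex_hadamard H \<longleftrightarrow>
     (\<forall>i j. cmod (H $ i $ j) = 1) \<and>
     H ** transpose (map_matrix cnj H) = mat (of_nat CARD('n))"

text \<open>
  Only this notion depends on an ordering of the vertices: the first row and column are those of
  the least index.
\<close>

definition dephased :: "((complex, 'n::{finite,linorder}) vec, 'n) vec \<Rightarrow> bool" where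
  "dephased H \<longleftrightarrow> (\<forall>j. H $ Min UNIV $ j = 1) \<and> (\<forall>i. H $ i $ Min UNIV = 1)"

end

theory Submission
  imports Defs
begin

text \<open>
  Since \<open>M\<close> is symmetric, \<open>U(t)\<close> is symmetric and unitary, so any limit of \<open>\<surd>n U(\<tau>\<^sub>m)\<close> is a symmetric
  \<open>H\<close> with \<open>H H\<^sup>* = n I\<close>; uniform mixing provides times at which the moduli of the entries tend
  to \<open>1 / \<surd>n\<close>, and a convergent subsequence exists because \<open>U(t)\<close> is bounded.
  As \<open>U(t)\<close> commutes with \<open>M\<close>, also \<open>H M H\<^sup>* = n M\<close>. For a dephased \<open>H\<close> the \<open>(1,1)\<close> entry of this
  identity says that the sum of all entries of \<open>M\<close> is \<open>n M\<^sub>1\<^sub>1\<close>. This is impossible for \<open>A\<close>, whose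
  diagonal vanishes and whose entry sum is positive, and for \<open>L\<close>, whose entry sum vanishes and whose
  diagonal is positive.
\<close>

section \<open>The matrix exponential\<close>

lemma map_matrix_nth [simp]: "map_matrix f A $ i $ j = f (A $ i $ j)"
  by (simp add: map_matrix_def)

lemma transpose_map_matrix: "transpose (map_matrix f A) = map_matrix f (transpose A)"
  by (simp add: transpose_def vec_eq_iff)

section \<open>Powers with respect to the matrix product\<close>

lemma matrix_pow_add: "matrix_pow B (j + k) = matrix_pow B j ** matrix_pow B k"
  by (induction j) (simp_all add: matrix_mul_assoc)

lemma matrix_pow_commute: "B ** matrix_pow B k = matrix_pow B k ** B"
  using matrix_pow_add[of B k 1] by simp

text \<open>Transposition reverses the product in the recursion; the order is restored because a
  matrix commutes with its powers.\<close>

lemma transpose_matrix_pow: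
  fixes B :: "'a::comm_semiring_1^'n^'n"
  shows "transpose (matrix_pow B k) = matrix_pow (transpose B) k"
proof (induction k)
  case (Suc k)
  have "transpose (matrix_pow B (Suc k)) = matrix_pow (transpose B) k ** transpose B"
    by (simp add: matrix_transpose_mul Suc)
  then show ?case
    by (simp add: matrix_pow_commute)
qed (simp add: transpose_mat)

lemma matrix_pow_uminus_nth:
  fixes B :: "'a::comm_ring_1^'n^'n"
  shows "matrix_pow (- B) k $ i $ j = (- 1) ^ k * matrix_pow B k $ i $ j"
proof (induction k arbitrary: i j)
  case (Suc k)
  then show ?case
    by (simp add: matrix_matrix_mult_def sum_distrib_left mult_ac flip: sum_negf)
qed (simp add: mat_def)

lemma matrix_pow_cnj_nth:
  "matrix_pow (map_matrix cnj B) k $ i $ j = cnj (matrix_pow B k $ i $ j)"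
proof (induction k arbitrary: i j)
  case (Suc k)
  then show ?case
    by (simp add: matrix_matrix_mult_def)
qed (simp add: mat_def)

section \<open>Absolute convergence of the exponential series\<close>

lemma norm_matrix_pow_nth_le:
  fixes B :: "complex^'n^'n"
  assumes "\<And>i j. cmod (B $ i $ j) \<le> b" "0 \<le> b"
  shows "cmod (matrix_pow B k $ i $ j) \<le> (real CARD('n) * b) ^ k"
proof (induction k arbitrary: i j)
  case (Suc k)
  have "cmod (matrix_pow B (Suc k) $ i $ j) \<le>
      (\<Sum>l\<in>UNIV. cmod (B $ i $ l * matrix_pow B k $ l $ j))"
    by (simp add: matrix_matrix_mult_def norm_sum)
  also have "\<dots> \<le> (\<Sum>l\<in>(UNIV::'n set). b * (real CARD('n) * b) ^ k)"
    by (intro sum_mono) (auto simp: norm_mult intro!: mult_mono assms Suc)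
  finally show ?case
    by simp
qed (simp add: mat_def)

text \<open>With \<open>b\<close> the largest modulus of an entry, the series is dominated by the
  scalar exponential series at \<open>n * b\<close>. Absolute convergence is what later permits
  Cauchy products.\<close>

lemma summable_norm_matrix_exp_nth:
  fixes B :: "complex^'n^'n"
  shows "summable (\<lambda>k. norm (matrix_pow B k $ i $ j / fact k))"
proof -
  define b where "b = Max (range (\<lambda>(i, j). cmod (B $ i $ j)))"
  have le: "cmod (B $ i $ j) \<le> b" for i j
    unfolding b_def by (rule Max_ge) auto
  have "0 \<le> b"
    using le norm_ge_zero order_trans by blast
  show ?thesis
  proof (rule summable_comparison_test[OF _ summable_exp])
    show "\<exists>N. \<forall>k\<ge>N. norm (norm (matrix_pow B k $ i $ j / fact k))
        \<le> inverse (fact k) * (real CARD('n) * b) ^ k"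
      using norm_matrix_pow_nth_le[OF le \<open>0 \<le> b\<close>]
      by (simp add: norm_divide divide_right_mono inverse_eq_divide)
  qed
qed

text \<open>Convergence in a finite product is convergence of each coordinate, so identities for
  \<open>matrix_exp\<close> reduce to scalar series.\<close>

lemma matrix_exp_nth:
  fixes B :: "complex^'n^'n"
  shows "matrix_exp B $ i $ j = (\<Sum>k. matrix_pow B k $ i $ j / fact k)"
proof -
  define S where "S = (\<chi> i j. \<Sum>k. matrix_pow B k $ i $ j / fact k)"
  have "(\<lambda>k. (1 / fact k) *\<^sub>R matrix_pow B k) sums S"
    unfolding sums_def
  proof (intro vec_tendstoI)
    fix i j
    have "(\<lambda>k. matrix_pow B k $ i $ j / fact k) sums (S $ i $ j)"
      unfolding S_def vec_lambda_beta
      by (intro summable_sums summable_norm_matrix_exp_nth[THEN summable_norm_cancel])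
    then show "(\<lambda>n. (\<Sum>k<n. (1 / fact k) *\<^sub>R matrix_pow B k) $ i $ j) \<longlonglongrightarrow> S $ i $ j"
      by (simp add: sums_def scaleR_conv_of_real[where 'a=complex] field_simps)
  qed
  then show ?thesis
    by (simp add: matrix_exp_def S_def sums_iff)
qed

section \<open>Inverse, transpose, conjugate and commutation\<close>

lemma matrix_exp_minus: "matrix_exp B ** matrix_exp (- B) = mat 1"
proof -
  have "(matrix_exp B ** matrix_exp (- B)) $ i $ j = mat 1 $ i $ j" for i j
  proof -
    let ?a = "\<lambda>C i j k. matrix_pow C k $ i $ j / fact k"
    \<comment> \<open>Each summand of the matrix product is a product of two absolutely convergent
      series, hence the sum of their Cauchy product; the sum over \<open>l\<close> is
      finite.\<close>
    have "(\<lambda>k. \<Sum>p\<le>k. ?a B i l p * ?a (- B) l j (k - p)) sums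
        (matrix_exp B $ i $ l * matrix_exp (- B) $ l $ j)" for l
      unfolding matrix_exp_nth
      by (intro Cauchy_product_sums summable_norm_matrix_exp_nth)
    then have "(\<lambda>k. \<Sum>l\<in>UNIV. \<Sum>p\<le>k. ?a B i l p * ?a (- B) l j (k - p)) sums
        ((matrix_exp B ** matrix_exp (- B)) $ i $ j)"
      unfolding matrix_matrix_mult_def by (simp add: sums_sum)
    moreover have "(\<Sum>l\<in>UNIV. \<Sum>p\<le>k. ?a B i l p * ?a (- B) l j (k - p)) =
        (if k = 0 then mat 1 $ i $ j else 0)" for k
    proof -
      have "(\<Sum>l\<in>UNIV. \<Sum>p\<le>k. ?a B i l p * ?a (- B) l j (k - p)) =
          (\<Sum>p\<le>k. \<Sum>l\<in>UNIV. (- 1) ^ (k - p) / (fact p * fact (k - p)) *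
            (matrix_pow B p $ i $ l * matrix_pow B (k - p) $ l $ j))"
        by (subst sum.swap) (simp add: matrix_pow_uminus_nth mult_ac)
      also have "\<dots> = (\<Sum>p\<le>k. (- 1) ^ (k - p) / (fact p * fact (k - p)) *
          (matrix_pow B p ** matrix_pow B (k - p)) $ i $ j)"
        by (simp add: matrix_matrix_mult_def sum_distrib_left)
      \<comment> \<open>The two powers combine to \<open>matrix_pow B k\<close>, which does not
        depend on \<open>p\<close>, and the factorials become binomial coefficients over
        \<open>fact k\<close>.\<close>
      also have "\<dots> = (\<Sum>p\<le>k. (- 1) ^ (k - p) * of_nat (k choose p)) *
          (matrix_pow B k $ i $ j / fact k)"
        unfolding sum_distrib_right
        by (intro sum.cong) (simp_all add: binomial_fact flip: matrix_pow_add)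
      \<comment> \<open>By the binomial theorem the coefficient is a power of zero, so only degree
        \<open>k = 0\<close> survives.\<close>
      also have "(\<Sum>p\<le>k. (- 1) ^ (k - p) * of_nat (k choose p)) = (1 + - 1 :: complex) ^ k"
        unfolding binomial_ring by (simp add: mult_ac)
      finally show ?thesis
        by (simp add: power_0_left)
    qed
    ultimately have "(\<lambda>k. if k = 0 then mat 1 $ i $ j else 0) sums
        ((matrix_exp B ** matrix_exp (- B)) $ i $ j)"
      by simp
    then show ?thesis
      using sums_single[of 0 "\<lambda>_. mat 1 $ i $ j"] by (rule sums_unique2)
  qed
  then show ?thesis
    by (simp add: vec_eq_iff)
qed

lemma transpose_matrix_exp: "transpose (matrix_exp B) = matrix_exp (transpose B)"
proof -
  have "matrix_pow B k $ j $ i = matrix_pow (transpose B) k $ i $ j" for i j k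
    unfolding transpose_matrix_pow[symmetric] by (simp add: transpose_def)
  then show ?thesis
    by (simp add: vec_eq_iff matrix_exp_nth transpose_def)
qed

text \<open>Conjugation is bounded and real-linear, so it passes through the series.\<close>

lemma matrix_exp_cnj: "matrix_exp (map_matrix cnj B) = map_matrix cnj (matrix_exp B)"
proof -
  have "cnj (\<Sum>k. matrix_pow B k $ i $ j / fact k) =
      (\<Sum>k. cnj (matrix_pow B k $ i $ j / fact k))" for i j
    by (rule bounded_linear.suminf[OF bounded_linear_cnj])
      (rule summable_norm_matrix_exp_nth[THEN summable_norm_cancel])
  then show ?thesis
    by (simp add: vec_eq_iff matrix_exp_nth matrix_pow_cnj_nth)
qed

text \<open>Multiplying the series termwise by \<open>B\<close> on either side gives the same terms,
  so both products are the sum of one series.\<close>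

lemma matrix_exp_commute: "B ** matrix_exp B = matrix_exp B ** B"
proof -
  let ?P = "matrix_pow B"
  have sms: "(\<lambda>k. ?P k $ i $ j / fact k) sums (matrix_exp B $ i $ j)" for i j
    unfolding matrix_exp_nth
    by (intro summable_sums summable_norm_matrix_exp_nth[THEN summable_norm_cancel])
  have "(B ** matrix_exp B) $ i $ j = (matrix_exp B ** B) $ i $ j" for i j
  proof (rule sums_unique2)
    show "(\<lambda>k. (B ** ?P k) $ i $ j / fact k) sums ((B ** matrix_exp B) $ i $ j)"
      using sums_sum[of UNIV "\<lambda>l k. B $ i $ l * (?P k $ l $ j / fact k)", OF sums_mult[OF sms]]
      by (simp add: matrix_matrix_mult_def sum_divide_distrib)
    show "(\<lambda>k. (B ** ?P k) $ i $ j / fact k) sums ((matrix_exp B ** B) $ i $ j)"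
      using sums_sum[of UNIV "\<lambda>l k. ?P k $ i $ l / fact k * B $ l $ j", OF sums_mult2[OF sms]]
      unfolding matrix_pow_commute by (simp add: matrix_matrix_mult_def sum_divide_distrib)
  qed
  then show ?thesis
    by (simp add: vec_eq_iff)
qed

section \<open>The transition matrix\<close>

text \<open>As \<open>M\<close> is real, conjugating the exponent \<open>itM\<close> negates it, so
  the conjugate of \<open>U(t)\<close> is its inverse. This becomes unitarity once
  \<open>U(t)\<close> is known to be symmetric.\<close>

lemma transition_matrix_unitary:
  "transition_matrix M t ** map_matrix cnj (transition_matrix M t) = mat 1"
proof -
  define B where "B = map_matrix (\<lambda>x. \<i> * complex_of_real t * complex_of_real x) M"
  have "map_matrix cnj B = - B"
    by (simp add: B_def vec_eq_iff)
  then show ?thesis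
    unfolding transition_matrix_def B_def[symmetric]
    by (simp add: matrix_exp_minus flip: matrix_exp_cnj)
qed

lemma transpose_transition_matrix:
  assumes "transpose M = M"
  shows "transpose (transition_matrix M t) = transition_matrix M t"
  by (simp add: transition_matrix_def transpose_matrix_exp transpose_map_matrix assms)

text \<open>The exponent commutes with its exponential, and the scalar \<open>it\<close> can be
  cancelled when \<open>t\<close> is nonzero; at \<open>t = 0\<close> the matrix \<open>U(t)\<close>
  is the identity.\<close>

lemma transition_matrix_commute:
  "map_matrix complex_of_real M ** transition_matrix M t =
   transition_matrix M t ** map_matrix complex_of_real M"
proof (cases "t = 0")
  case True
  have "map_matrix (\<lambda>x. \<i> * complex_of_real 0 * complex_of_real x) M = 0"
    by (simp add: vec_eq_iff)
  moreover have pow: "matrix_pow (0 :: complex^'a^'a) k $ i $ j / fact k =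
      (if k = 0 then mat 1 $ i $ j else 0)" for k i j
    by (cases k) (simp_all add: matrix_matrix_mult_def)
  have "matrix_exp (0 :: complex^'a^'a) $ i $ j = mat 1 $ i $ j" for i j
    unfolding matrix_exp_nth pow
    using sums_single[of 0 "\<lambda>_. mat 1 $ i $ j :: complex"] by (simp add: sums_iff)
  then have "matrix_exp (0 :: complex^'a^'a) = mat 1"
    by (simp add: vec_eq_iff)
  ultimately show ?thesis
    by (simp add: transition_matrix_def True)
next
  case False
  define B where "B = map_matrix (\<lambda>x. \<i> * complex_of_real t * complex_of_real x) M"
  let ?C = "map_matrix complex_of_real M" and ?c = "\<i> * complex_of_real t"
  have [simp]: "B $ i $ j = ?c * ?C $ i $ j" for i j
    by (simp add: B_def)
  have "(B ** matrix_exp B) $ i $ j = ?c * (?C ** matrix_exp B) $ i $ j" for i j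
    by (simp add: matrix_matrix_mult_def sum_distrib_left mult_ac)
  moreover have "(matrix_exp B ** B) $ i $ j = ?c * (matrix_exp B ** ?C) $ i $ j" for i j
    by (simp add: matrix_matrix_mult_def sum_distrib_left mult_ac)
  ultimately have "?c * (?C ** matrix_exp B) $ i $ j = ?c * (matrix_exp B ** ?C) $ i $ j" for i j
    by (metis matrix_exp_commute)
  then show ?thesis
    using False by (simp add: transition_matrix_def B_def vec_eq_iff)
qed

lemma transition_matrix_conjugation:
  assumes "transpose M = M"
  shows "transition_matrix M t ** map_matrix complex_of_real M **
    transpose (map_matrix cnj (transition_matrix M t)) = map_matrix complex_of_real M"
proof -
  have "transpose (map_matrix cnj (transition_matrix M t)) =
      map_matrix cnj (transition_matrix M t)"
    by (simp add: transpose_map_matrix transpose_transition_matrix[OF assms])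
  then show ?thesis
    by (simp add: transition_matrix_unitary flip: transition_matrix_commute matrix_mul_assoc)
qed

text \<open>By unitarity and symmetry the squared moduli in each row sum to 1.\<close>

lemma norm_transition_matrix_nth_le:
  assumes "transpose M = M"
  shows "cmod (transition_matrix M t $ i $ j) \<le> 1"
proof -
  let ?U = "transition_matrix M t"
  have sym: "?U $ l $ i = ?U $ i $ l" for l
    using transpose_transition_matrix[OF assms, of t] by (simp add: transpose_def vec_eq_iff)
  have "(\<Sum>l\<in>UNIV. ?U $ i $ l * cnj (?U $ l $ i)) = 1"
    using transition_matrix_unitary[of M t]
    by (simp add: matrix_matrix_mult_def mat_def vec_eq_iff)
  then have "complex_of_real (\<Sum>l\<in>UNIV. (cmod (?U $ i $ l))\<^sup>2) = complex_of_real 1"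
    unfolding sym by (simp add: complex_norm_square del: of_real_power)
  then have "(\<Sum>l\<in>UNIV. (cmod (?U $ i $ l))\<^sup>2) = 1"
    by (simp only: of_real_eq_iff)
  then have "(cmod (?U $ i $ j))\<^sup>2 \<le> 1\<^sup>2"
    using member_le_sum[of j UNIV "\<lambda>l. (cmod (?U $ i $ l))\<^sup>2"] by simp
  then show ?thesis
    by (rule power2_le_imp_le) simp
qed

section \<open>Limits of the transition matrix\<close>

lemma tendsto_matrix_nth:
  assumes "(X \<longlongrightarrow> H) F"
  shows "((\<lambda>m. X m $ i $ j) \<longlongrightarrow> H $ i $ j) F"
  using assms by (intro tendsto_vec_nth)

lemma tendsto_matrix_matrix_mult:
  fixes X :: "'b \<Rightarrow> 'a::real_normed_algebra_1^'n^'m" and Y :: "'b \<Rightarrow> 'a^'p^'n"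
  assumes "(X \<longlongrightarrow> H) F" "(Y \<longlongrightarrow> K) F"
  shows "((\<lambda>m. X m ** Y m) \<longlongrightarrow> H ** K) F"
  unfolding matrix_matrix_mult_def
  by (intro vec_tendstoI) (auto intro!: tendsto_intros assms)

lemma tendsto_transpose_cnj:
  assumes "(X \<longlongrightarrow> H) F"
  shows "((\<lambda>m. transpose (map_matrix cnj (X m))) \<longlongrightarrow> transpose (map_matrix cnj H)) F"
  unfolding transpose_def
  by (intro vec_tendstoI) (auto intro!: tendsto_intros assms)

lemma limit_transition_matrix_symmetric:
  assumes "transpose M = M"
    and "(\<lambda>m. r *\<^sub>R transition_matrix M (\<tau> m)) \<longlonglongrightarrow> H"
  shows "transpose H = H"
proof -
  have "transition_matrix M t $ j $ i = transition_matrix M t $ i $ j" for t i j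
    using transpose_transition_matrix[OF assms(1), of t] by (simp add: transpose_def vec_eq_iff)
  then have "H $ j $ i = H $ i $ j" for i j
    using tendsto_matrix_nth[OF assms(2), of i j] tendsto_matrix_nth[OF assms(2), of j i]
    by (auto intro: LIMSEQ_unique)
  then show ?thesis
    by (simp add: transpose_def vec_eq_iff)
qed

text \<open>The scaled matrices satisfy this identity at every time with a constant right-hand side,
  and both sides are continuous in the matrix.\<close>

lemma limit_transition_matrix_unitary:
  assumes "transpose M = M"
    and "(\<lambda>m. sqrt (real CARD('n)) *\<^sub>R transition_matrix M (\<tau> m)) \<longlonglongrightarrow> (H :: complex^'n^'n)"
  shows "H ** transpose (map_matrix cnj H) = mat (of_nat CARD('n))"
proof -
  let ?r = "sqrt (real CARD('n))" and ?U = "transition_matrix M"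
  have "(?r *\<^sub>R ?U t) ** transpose (map_matrix cnj (?r *\<^sub>R ?U t)) = mat (of_nat CARD('n))" for t
  proof -
    have sym: "?U t $ j $ i = ?U t $ i $ j" for i j
      using transpose_transition_matrix[OF assms(1), of t] by (simp add: transpose_def vec_eq_iff)
    have "((?r *\<^sub>R ?U t) ** transpose (map_matrix cnj (?r *\<^sub>R ?U t))) $ i $ j =
        of_real (?r * ?r) * (?U t ** map_matrix cnj (?U t)) $ i $ j" for i j
      by (simp add: matrix_matrix_mult_def transpose_def sum_distrib_left
          sym[of j] scaleR_conv_of_real[where 'a=complex] mult_ac del: real_sqrt_mult_self)
    then show ?thesis
      by (simp add: transition_matrix_unitary vec_eq_iff mat_def)
  qed
  then show ?thesis
    using tendsto_matrix_matrix_mult[OF assms(2) tendsto_transpose_cnj[OF assms(2)]]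
    by (simp add: LIMSEQ_const_iff)
qed

lemma limit_transition_matrix_conjugation:
  assumes "transpose M = M"
    and "(\<lambda>m. sqrt (real CARD('n)) *\<^sub>R transition_matrix M (\<tau> m)) \<longlonglongrightarrow> (H :: complex^'n^'n)"
  shows "H ** map_matrix complex_of_real M ** transpose (map_matrix cnj H) =
    real CARD('n) *\<^sub>R map_matrix complex_of_real M"
proof -
  let ?r = "sqrt (real CARD('n))" and ?U = "transition_matrix M"
    and ?C = "map_matrix complex_of_real M"
  have "(?r *\<^sub>R ?U t) ** ?C ** transpose (map_matrix cnj (?r *\<^sub>R ?U t)) = real CARD('n) *\<^sub>R ?C" for t
  proof -
    have "((?r *\<^sub>R ?U t) ** ?C ** transpose (map_matrix cnj (?r *\<^sub>R ?U t))) $ i $ j =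
        of_real (?r * ?r) * (?U t ** ?C ** transpose (map_matrix cnj (?U t))) $ i $ j" for i j
      by (simp add: matrix_matrix_mult_def transpose_def sum_distrib_left
          sum_distrib_right scaleR_conv_of_real[where 'a=complex] mult_ac del: real_sqrt_mult_self)
    then show ?thesis
      by (simp add: transition_matrix_conjugation[OF assms(1)] vec_eq_iff scaleR_conv_of_real[where 'a=complex])
  qed
  then show ?thesis
    using tendsto_matrix_matrix_mult[OF tendsto_matrix_matrix_mult[OF assms(2) tendsto_const[of ?C]]
        tendsto_transpose_cnj[OF assms(2)]]
    by (simp add: LIMSEQ_const_iff)
qed

text \<open>If the first row of \<open>H\<close> is all ones, the first diagonal entry of
  \<open>H M H*\<close> is the sum of all entries of \<open>M\<close>; the conjugation identity
  equates it with \<open>n\<close> times the first diagonal entry of \<open>M\<close>.\<close>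

lemma dephased_limit_imp_sum_eq:
  fixes M :: "((real, 'v::{finite,linorder}) vec, 'v) vec"
  assumes "transpose M = M"
    and "(\<lambda>m. sqrt (real CARD('v)) *\<^sub>R transition_matrix M (\<tau> m)) \<longlonglongrightarrow> H"
    and "dephased H"
  shows "(\<Sum>i\<in>UNIV. \<Sum>j\<in>UNIV. M $ i $ j) = real CARD('v) * M $ Min UNIV $ Min UNIV"
proof -
  have "(H ** map_matrix complex_of_real M ** transpose (map_matrix cnj H)) $ Min UNIV $ Min UNIV =
      complex_of_real (\<Sum>j\<in>UNIV. \<Sum>i\<in>UNIV. M $ i $ j)"
    using assms(3) by (simp add: dephased_def matrix_matrix_mult_def transpose_def)
  then have "complex_of_real (\<Sum>j\<in>UNIV. \<Sum>i\<in>UNIV. M $ i $ j) =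
      complex_of_real (real CARD('v) * M $ Min UNIV $ Min UNIV)"
    unfolding limit_transition_matrix_conjugation[OF assms(1,2)]
    by (simp add: scaleR_conv_of_real[where 'a=complex])
  then have "(\<Sum>j\<in>UNIV. \<Sum>i\<in>UNIV. M $ i $ j) = real CARD('v) * M $ Min UNIV $ Min UNIV"
    by (simp only: of_real_eq_iff)
  then show ?thesis
    by (subst sum.swap)
qed

section \<open>Uniform mixing\<close>

text \<open>Multiplying \<open>U\<close> applied to \<open>axis u 1\<close> by its conjugate yields
  squared moduli, so the mixing condition concerns only the moduli of the entries of
  \<open>U\<close>.\<close>

lemma mixing_defect_nth:
  fixes U :: "complex^'n^'n"
  shows "((U *v axis u 1) * (map_matrix cnj U *v axis u 1) - c *\<^sub>R 1) $ v =
    of_real ((cmod (U $ v $ u))\<^sup>2 - c)"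
  by (simp add: matrix_vector_mult_def axis_def if_distrib[of "(*) _"] complex_norm_square
      scaleR_conv_of_real[where 'a=complex] del: of_real_power)

text \<open>Stated for any real symmetric matrix, so that all three graph matrices are covered at
  once.\<close>

lemma eps_uniform_mixing_iff_limit:
  fixes M :: "real^'v^'v"
  assumes sym: "transpose M = M"
  shows "eps_uniform_mixing M \<longleftrightarrow>
    (\<exists>(\<tau> :: nat \<Rightarrow> real) H.
      (\<lambda>m. sqrt (real CARD('v)) *\<^sub>R transition_matrix M (\<tau> m)) \<longlonglongrightarrow> H \<and>
      complex_hadamard H \<and> transpose H = H)"
proof
  let ?n = "real CARD('v)" and ?U = "transition_matrix M"
  define f where "f t u = (?U t *v axis u 1) * (map_matrix cnj (?U t) *v axis u 1)
    - (1 / ?n) *\<^sub>R (1 :: complex^'v)" for t u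
  have f_nth: "f t u $ v = of_real ((cmod (?U t $ v $ u))\<^sup>2 - 1 / ?n)" for t u v
    unfolding f_def by (rule mixing_defect_nth)
  have mixing: "eps_uniform_mixing M \<longleftrightarrow> (\<forall>\<epsilon>>0. \<exists>\<tau>. \<forall>u. norm (f \<tau> u) < \<epsilon>)"
    by (simp add: eps_uniform_mixing_def f_def)
  {
    assume "eps_uniform_mixing M"
    \<comment> \<open>Tolerances \<open>1 / (m + 1)\<close> tend to 0; one time is chosen for
      each.\<close>
    then have "\<exists>t. \<forall>u. norm (f t u) < 1 / real (Suc m)" for m
      unfolding mixing by simp
    then obtain \<tau> where \<tau>: "norm (f (\<tau> m) u) < 1 / real (Suc m)" for m u
      by metis
    have modulus: "(\<lambda>m. (cmod (?U (\<tau> m) $ i $ j))\<^sup>2) \<longlonglongrightarrow> 1 / ?n" for i j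
    proof -
      have "(\<lambda>m. f (\<tau> m) j $ i) \<longlonglongrightarrow> 0"
      proof (rule Lim_null_comparison[OF _ LIMSEQ_Suc[OF lim_1_over_n]])
        show "\<forall>\<^sub>F m in sequentially. norm (f (\<tau> m) j $ i) \<le> 1 / real (Suc m)"
          by (rule always_eventually)
            (blast intro: order_trans[OF Finite_Cartesian_Product.norm_nth_le less_imp_le[OF \<tau>]])
      qed
      then have "(\<lambda>m. complex_of_real ((cmod (?U (\<tau> m) $ i $ j))\<^sup>2 - 1 / ?n)) \<longlonglongrightarrow> of_real 0"
        by (simp add: f_nth)
      then have "(\<lambda>m. (cmod (?U (\<tau> m) $ i $ j))\<^sup>2 - 1 / ?n) \<longlonglongrightarrow> 0"
        by (simp only: tendsto_of_real_iff)
      then show ?thesis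
        by (simp add: LIM_zero_iff)
    qed
    \<comment> \<open>The norm is at most the sum of the moduli of the \<open>n * n\<close> entries,
      each at most 1. Boundedness then gives a convergent subsequence by
      Bolzano-Weierstrass.\<close>
    have "bounded (range (\<lambda>m. sqrt ?n *\<^sub>R ?U (\<tau> m)))"
    proof (rule boundedI, clarify)
      fix m
      have "norm (?U (\<tau> m)) \<le> (\<Sum>i\<in>UNIV. norm (?U (\<tau> m) $ i))"
        unfolding norm_vec_def by (rule L2_set_le_sum) simp
      also have "\<dots> \<le> (\<Sum>i\<in>UNIV. \<Sum>j\<in>UNIV. cmod (?U (\<tau> m) $ i $ j))"
      proof (rule sum_mono)
        fix i
        show "norm (?U (\<tau> m) $ i) \<le> (\<Sum>j\<in>UNIV. cmod (?U (\<tau> m) $ i $ j))"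
          unfolding norm_vec_def[of "?U (\<tau> m) $ i"] by (rule L2_set_le_sum) simp
      qed
      also have "\<dots> \<le> (\<Sum>i\<in>(UNIV :: 'v set). \<Sum>j\<in>(UNIV :: 'v set). 1)"
        by (intro sum_mono norm_transition_matrix_nth_le sym)
      finally show "norm (sqrt ?n *\<^sub>R ?U (\<tau> m)) \<le> sqrt ?n * (?n * ?n)"
        by (simp add: mult_left_mono)
    qed
    then obtain H s where s: "strict_mono s"
      and lim: "((\<lambda>m. sqrt ?n *\<^sub>R ?U (\<tau> m)) \<circ> s) \<longlonglongrightarrow> H"
      using bounded_imp_convergent_subsequence by blast
    then have lim': "(\<lambda>m. sqrt ?n *\<^sub>R ?U ((\<tau> \<circ> s) m)) \<longlonglongrightarrow> H"
      by (simp add: o_def)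
    have "cmod (H $ i $ j) = 1" for i j
    proof -
      have "(\<lambda>m. (cmod ((sqrt ?n *\<^sub>R ?U ((\<tau> \<circ> s) m)) $ i $ j))\<^sup>2) \<longlonglongrightarrow> (cmod (H $ i $ j))\<^sup>2"
        by (intro tendsto_power tendsto_norm tendsto_matrix_nth lim')
      moreover have "(\<lambda>m. ?n * (cmod (?U (\<tau> (s m)) $ i $ j))\<^sup>2) \<longlonglongrightarrow> ?n * (1 / ?n)"
        using LIMSEQ_subseq_LIMSEQ[OF modulus s] by (intro tendsto_mult_left) (simp add: o_def)
      ultimately have "(cmod (H $ i $ j))\<^sup>2 = 1"
        by (simp add: power_mult_distrib LIMSEQ_unique)
      then show ?thesis
        using norm_ge_zero[of "H $ i $ j"] by (auto simp: power2_eq_1_iff simp del: norm_ge_zero)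
    qed
    then show "\<exists>\<tau> H. (\<lambda>m. sqrt ?n *\<^sub>R ?U (\<tau> m)) \<longlonglongrightarrow> H \<and> complex_hadamard H \<and> transpose H = H"
      using lim' limit_transition_matrix_symmetric[OF sym lim']
        limit_transition_matrix_unitary[OF sym lim']
      unfolding complex_hadamard_def by blast
  }
  assume "\<exists>\<tau> H. (\<lambda>m. sqrt ?n *\<^sub>R ?U (\<tau> m)) \<longlonglongrightarrow> H \<and> complex_hadamard H \<and> transpose H = H"
  then obtain \<tau> H where lim: "(\<lambda>m. sqrt ?n *\<^sub>R ?U (\<tau> m)) \<longlonglongrightarrow> H" and H: "complex_hadamard H"
    by blast
  have "(\<lambda>m. norm (f (\<tau> m) u)) \<longlonglongrightarrow> 0" for u
  proof (intro tendsto_norm_zero vec_tendstoI)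
    fix v
    have "(\<lambda>m. (cmod ((sqrt ?n *\<^sub>R ?U (\<tau> m)) $ v $ u))\<^sup>2 / ?n - 1 / ?n) \<longlonglongrightarrow>
        (cmod (H $ v $ u))\<^sup>2 / ?n - 1 / ?n"
      by (intro tendsto_intros tendsto_matrix_nth lim) simp
    then have "(\<lambda>m. (cmod (?U (\<tau> m) $ v $ u))\<^sup>2 - 1 / ?n) \<longlonglongrightarrow> 0"
      using H by (simp add: complex_hadamard_def power_mult_distrib)
    then have "(\<lambda>m. f (\<tau> m) u $ v) \<longlonglongrightarrow> of_real 0"
      unfolding f_nth by (rule tendsto_of_real)
    then show "(\<lambda>m. f (\<tau> m) u $ v) \<longlonglongrightarrow> 0 $ v"
      by simp
  qed
  then have "\<forall>\<^sub>F m in sequentially. norm (f (\<tau> m) u) < \<epsilon>" if "\<epsilon> > 0" for \<epsilon> u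
    using that by (rule order_tendstoD(2))
  \<comment> \<open>Finitely many eventual bounds hold eventually together, which yields a single
    time for all vertices.\<close>
  then have "\<forall>\<^sub>F m in sequentially. \<forall>u. norm (f (\<tau> m) u) < \<epsilon>" if "\<epsilon> > 0" for \<epsilon>
    by (rule eventually_all_finite) (use that in simp)
  then have "\<exists>m. \<forall>u. norm (f (\<tau> m) u) < \<epsilon>" if "\<epsilon> > 0" for \<epsilon>
    using that eventually_happens'[OF sequentially_bot] by blast
  then show "eps_uniform_mixing M"
    unfolding mixing by blast
qed

section \<open>Matrices of a weighted graph\<close>

context weighted_graph
begin

lemma adjacency_matrix_sym: "adjacency_matrix E w $ u $ v = adjacency_matrix E w $ v $ u"
  by (simp add: adjacency_matrix_def insert_commute)

text \<open>The set \<open>{u, u}\<close> has one element, so it is not an edge.\<close>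

lemma adjacency_matrix_diag [simp]: "adjacency_matrix E w $ u $ u = 0"
  using edge_card[of "{u}"] by (auto simp: adjacency_matrix_def)

text \<open>Sending a neighbour \<open>v\<close> to \<open>{u, v}\<close> is a bijection onto the
  edges at \<open>u\<close>, so the sum over edges becomes a row sum.\<close>

lemma degree_matrix_diag: "degree_matrix E w $ u $ u = (\<Sum>v\<in>UNIV. adjacency_matrix E w $ u $ v)"
proof -
  have "bij_betw (\<lambda>v. {u, v}) {v. {u, v} \<in> E} {e \<in> E. u \<in> e}"
  proof (rule bij_betwI')
    fix e assume e: "e \<in> {e \<in> E. u \<in> e}"
    then obtain x y where "e = {x, y}"
      using edge_card[of e] by (auto simp: card_2_iff)
    with e have "e = {u, if u = x then y else x}"
      by auto
    with e show "\<exists>v\<in>{v. {u, v} \<in> E}. e = {u, v}"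
      by auto
  qed (auto simp: doubleton_eq_iff)
  then have "(\<Sum>v | {u, v} \<in> E. w {u, v}) = (\<Sum>e | e \<in> E \<and> u \<in> e. w e)"
    by (rule sum.reindex_bij_betw)
  then show ?thesis
    by (simp add: degree_matrix_def adjacency_matrix_def sum.If_cases)
qed

lemma degree_matrix_diag_pos:
  assumes "CARD('v) \<ge> 2"
  shows "degree_matrix E w $ u $ u > 0"
proof -
  have "UNIV \<noteq> {u}"
  proof
    assume "UNIV = {u}"
    then have "CARD('v) = card {u}"
      by (rule arg_cong)
    with assms show False
      by simp
  qed
  then obtain v where "v \<noteq> u"
    by (auto simp: set_eq_iff)
  \<comment> \<open>The first step of a walk from \<open>u\<close> to a different vertex is an edge
    at \<open>u\<close>.\<close>
  from connected[of u v] obtain x where x: "{u, x} \<in> E"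
    by (cases rule: converse_rtranclpE) (use \<open>v \<noteq> u\<close> in auto)
  have "0 < (\<Sum>v\<in>UNIV. adjacency_matrix E w $ u $ v)"
    using x by (intro sum_pos2[of _ x])
      (auto simp: adjacency_matrix_def intro: weight_pos less_imp_le)
  then show ?thesis
    by (simp add: degree_matrix_diag)
qed

lemma sum_laplacian_matrix_row: "(\<Sum>v\<in>UNIV. laplacian_matrix E w $ u $ v) = 0"
proof -
  have "(\<Sum>v\<in>UNIV. degree_matrix E w $ u $ v) = degree_matrix E w $ u $ u"
    by (simp add: degree_matrix_def)
  then show ?thesis
    by (simp add: laplacian_matrix_def sum_subtractf degree_matrix_diag)
qed

lemma transpose_graph_matrix:
  assumes "M \<in> {adjacency_matrix E w, laplacian_matrix E w, signless_laplacian_matrix E w}"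
  shows "transpose M = M"
proof -
  have "degree_matrix E w $ u $ v = degree_matrix E w $ v $ u" for u v
    by (auto simp: degree_matrix_def)
  then have "M $ u $ v = M $ v $ u" for u v
    using assms adjacency_matrix_sym[of u v]
    by (auto simp: laplacian_matrix_def signless_laplacian_matrix_def)
  then show ?thesis
    by (simp add: transpose_def vec_eq_iff)
qed

text \<open>Positive degrees separate the two sides: for the adjacency matrix the left side is the
  sum of all degrees and the right side is 0; for the Laplacian the left side is 0 and the right
  side is \<open>n\<close> times a degree.\<close>

lemma sum_graph_matrix_neq_diag:
  assumes "CARD('v) \<ge> 2" and "M \<in> {adjacency_matrix E w, laplacian_matrix E w}"
  shows "(\<Sum>u\<in>UNIV. \<Sum>v\<in>UNIV. M $ u $ v) \<noteq> real CARD('v) * M $ x $ x"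
  using assms(2)
proof (elim insertE emptyE)
  assume "M = adjacency_matrix E w"
  moreover have "0 < (\<Sum>u\<in>UNIV. degree_matrix E w $ u $ u)"
    by (intro sum_pos degree_matrix_diag_pos assms) auto
  ultimately show ?thesis
    by (simp add: degree_matrix_diag)
next
  assume "M = laplacian_matrix E w"
  then show ?thesis
    using degree_matrix_diag_pos[OF assms(1), of x]
    by (simp add: sum_laplacian_matrix_row) (simp add: laplacian_matrix_def)
qed

end

text \<open>The bound on the number of vertices excludes the one-vertex graph: there both matrices
  vanish, \<open>U(t)\<close> is the identity and the limit \<open>H = 1\<close> is dephased.
  Non-dephasedness is claimed for every limit along every sequence of times.\<close>

theorem proposition2:
  fixes E :: "'v::{finite,linorder} set set" and w :: "'v set \<Rightarrow> real" and M :: "((real, 'v) vec, 'v) vec"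
  assumes "weighted_graph E w"
    and "M \<in> {adjacency_matrix E w, laplacian_matrix E w, signless_laplacian_matrix E w}"
  shows "(eps_uniform_mixing M \<longleftrightarrow>
           (\<exists>(\<tau> :: nat \<Rightarrow> real) H.
              (\<lambda>m. sqrt (real CARD('v)) *\<^sub>R transition_matrix M (\<tau> m)) \<longlonglongrightarrow> H \<and>
              complex_hadamard H \<and> transpose H = H)) \<and>
         (M \<in> {adjacency_matrix E w, laplacian_matrix E w} \<and> CARD('v) \<ge> 2 \<longrightarrow>
           (\<forall>(\<tau> :: nat \<Rightarrow> real) H.
              (\<lambda>m. sqrt (real CARD('v)) *\<^sub>R transition_matrix M (\<tau> m)) \<longlonglongrightarrow> H \<and>
              complex_hadamard H \<and> transpose H = H \<longrightarrow> \<not> dephased H))"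
proof -
  interpret weighted_graph E w by fact
  note sym = transpose_graph_matrix[OF assms(2)]
  show ?thesis
    using eps_uniform_mixing_iff_limit[OF sym] dephased_limit_imp_sum_eq[OF sym]
      sum_graph_matrix_neq_diag[of M "Min UNIV"]
    by blast
qed

end
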